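(* Let $t\ge 3$, let $q$ be an odd prime power, let $s$ be an integer with $1\le s\le 2t-1$ and $\gcd(s,2t)=1$, and let $(m,h)\in\mathbb{F}_{q^t}^*\times\mathbb{F}_{q^{2t}}$. The polynomial $$\psi_{m,h,s}= m\left(X^{q^s}-h^{1-q^{s(t+1)}}X^{q^{s(t+1)}}\right)+X^{q^{s(t-1)}}+h^{1-q^{s(2t-1)}}X^{q^{s(2t-1)}}$$ is scattered under one of the following assumptions: (i) $t$ is even, or $t$ is odd and $q\equiv 1\pmod 4$, and $m\in\mathbb{F}_{q^t}\setminus(\mathscr{P}^+_s\cup\mathscr{P}^-_s)$ with $\mathrm{N}_{q^{2t}/q^t}(h)=\pm1$; (ii) $t$ is odd, $q\equiv 3\pmod 4$, and either (a) $m\in\mathscr{P}^+_s$ with $\mathrm{N}_{q^{2t}/q^t}(h)=-1$, or (b) $m\in\mathbb{F}_{q^t}\setminus(\mathscr{P}^+_s\cup\mathscr{P}^-_s)$ with $\mathrm{N}_{q^{2t}/q^t}(h)=1$ and $h^2\ne-1$.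
   Context: Trace and norm: $\mathrm{Tr}_{q^{2t}/q^t}(x)=x+x^{q^t}$ and $\mathrm{N}_{q^{2t}/q^t}(x)=x^{q^t+1}$ for $x\in\mathbb{F}_{q^{2t}}$. $\mathscr{P}^+_s=\{w^{q^s+1}: w\in\ker\mathrm{Tr}_{q^{2t}/q^t}\}$ and $\mathscr{P}^-_s=\{w^{q^s-1}: w\in\ker\mathrm{Tr}_{q^{2t}/q^t}\}$; both are subsets of $\mathbb{F}_{q^t}$. $\psi_{m,h,s}$ is regarded as a $q^s$-linearized polynomial over $\mathbb{F}_{q^{2t}}$, taken modulo $X^{q^{2st}}-X$, i.e. as an $\mathbb{F}_q$-linear map $\mathbb{F}_{q^{2t}}\to\mathbb{F}_{q^{2t}}$. A linearized polynomial $f$ over $\mathbb{F}_{q^n}$ (here $n=2t$) is scattered if for all $y,z\in\mathbb{F}_{q^n}^*$ with $f(y)/y=f(z)/z$, the elements $y,z$ are $\mathbb{F}_q$-linearly dependent (equivalently, $f(X)+aX$ has at most $q$ roots in $\mathbb{F}_{q^n}$ for every $a\in\mathbb{F}_{q^n}$). *)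

theory Defs
  imports "HOL-Number_Theory.Number_Theory" "HOL-Computational_Algebra.Polynomial"
    "HOL-Library.Cardinality"
begin

text \<open>The ambient field of order \<open>q^(2t)\<close> is a type \<open>'a\<close> of sort \<open>{field, finite}\<close>
  with \<open>CARD('a) = q^(2*t)\<close>.\<close>

text \<open>If \<open>CARD('a)\<close> is a power of the prime power \<open>r\<close>, this is the unique subfield of order \<open>r\<close>.\<close>

definition subfield_of_order :: "nat \<Rightarrow> 'a :: {field, finite} set" where
  "subfield_of_order r = {x. x ^ r = x}"

text \<open>Relative trace and norm of the quadratic extension of the field of order \<open>r\<close>
  (here \<open>r = q^t\<close>).\<close>

definition rel_trace :: "nat \<Rightarrow> 'a :: {field, finite} \<Rightarrow> 'a" where
  "rel_trace r x = x + x ^ r"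

definition rel_norm :: "nat \<Rightarrow> 'a :: {field, finite} \<Rightarrow> 'a" where
  "rel_norm r x = x ^ (r + 1)"

definition P_plus :: "nat \<Rightarrow> nat \<Rightarrow> nat \<Rightarrow> 'a :: {field, finite} set" where
  "P_plus q t s = {w ^ (q ^ s + 1) | w. rel_trace (q ^ t) w = 0}"

definition P_minus :: "nat \<Rightarrow> nat \<Rightarrow> nat \<Rightarrow> 'a :: {field, finite} set" where
  "P_minus q t s = {w ^ (q ^ s - 1) | w. rel_trace (q ^ t) w = 0}"

text \<open>The exponents of \<open>h\<close> are negative integers, hence \<open>powi\<close>; this is the usual power
  whenever \<open>h \<noteq> 0\<close>.  The degree is below \<open>q^(2*s*t)\<close>, so the polynomial is already reduced
  modulo \<open>X^(q^(2*s*t)) - X\<close>.\<close>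

definition psi :: "nat \<Rightarrow> nat \<Rightarrow> 'a :: {field, finite} \<Rightarrow> 'a \<Rightarrow> nat \<Rightarrow> 'a poly" where
  "psi q t m h s =
     smult m (monom 1 (q ^ s)
              - monom (h powi (1 - int (q ^ (s * (t + 1))))) (q ^ (s * (t + 1))))
     + monom 1 (q ^ (s * (t - 1)))
     + monom (h powi (1 - int (q ^ (s * (2 * t - 1))))) (q ^ (s * (2 * t - 1)))"

definition linearized_poly :: "nat \<Rightarrow> 'a :: {field, finite} poly \<Rightarrow> bool" where
  "linearized_poly q f \<longleftrightarrow> (\<forall>k. coeff f k \<noteq> 0 \<longrightarrow> (\<exists>i. k = q ^ i))"

text \<open>Linear dependence of the pair \<open>(y, z)\<close> as a family, so that \<open>(y, y)\<close> is dependent.\<close>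

definition lin_dependent_pair :: "nat \<Rightarrow> 'a :: {field, finite} \<Rightarrow> 'a \<Rightarrow> bool" where
  "lin_dependent_pair q y z \<longleftrightarrow>
     (\<exists>a \<in> subfield_of_order q. \<exists>b \<in> subfield_of_order q.
        (a \<noteq> 0 \<or> b \<noteq> 0) \<and> a * y + b * z = 0)"

definition scattered :: "nat \<Rightarrow> 'a :: {field, finite} poly \<Rightarrow> bool" where
  "scattered q f \<longleftrightarrow> linearized_poly q f \<and>
     (\<forall>y z. y \<noteq> 0 \<longrightarrow> z \<noteq> 0 \<longrightarrow> poly f y / y = poly f z / z \<longrightarrow> lin_dependent_pair q y z)"

end

theory Submission
  imports Defs
begin

text \<open>
  Write \<open>\<sigma>\<close> for \<open>x \<mapsto> x^(q^s)\<close>, \<open>\<tau>\<close> for its inverse, and \<open>conj\<close> for \<open>x \<mapsto> x^(q^t)\<close>. The fixed field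
  \<open>K\<close> of \<open>conj\<close> has order \<open>q^t\<close>, and \<open>\<epsilon> = h * conj h\<close> is \<open>1\<close> or \<open>-1\<close>. Since \<open>s\<close> is odd, \<open>\<sigma>^t\<close> equals
  \<open>conj\<close>, and the polynomial acts as \<open>m * \<alpha> x + \<beta> x\<close>, where
  \<open>\<alpha> x = \<sigma> x - \<epsilon> * h * \<sigma> h * \<sigma> (conj x)\<close> is \<open>\<sigma>\<close>-semilinear and
  \<open>\<beta> x = \<tau> (conj x) + h / \<tau> h * \<tau> x\<close> is \<open>\<tau>\<close>-semilinear over \<open>K\<close>. Each has a kernel of dimension one.
  The kernels are different as soon as \<open>1 + \<epsilon> * h * \<sigma> (\<sigma> h) \<noteq> 0\<close>; then \<open>u\<close> in the kernel of \<open>\<alpha>\<close> and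
  \<open>v\<close> in the kernel of \<open>\<beta>\<close>, which exist by Hilbert 90, form a \<open>K\<close>-basis.

  Let \<open>y = a * u + b * v\<close> and \<open>z = a' * u + b' * v\<close> have the same slope, that is,
  \<open>(m * \<alpha> y + \<beta> y) * z = (m * \<alpha> z + \<beta> z) * y\<close>. In coordinates only four products occur. Two of them,
  \<open>\<alpha> v * v\<close> and \<open>\<beta> u * u\<close>, lie in \<open>K\<close> after division by \<open>h\<close>, so that subtracting the conjugate
  equation leaves a relation between \<open>Y = \<tau> a * b' - \<tau> a' * b\<close> and \<open>\<sigma> Y\<close> alone. If \<open>Y \<noteq> 0\<close>, this relation
  expresses \<open>m\<close> as \<open>\<sigma> w / w\<close> with \<open>w\<close> of trace zero. If \<open>Y = 0\<close>, then \<open>(a, a')\<close> is proportional to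
  \<open>(\<sigma> b, \<sigma> b')\<close>, and the rest of the equation says that \<open>y\<close> and \<open>z\<close> are dependent over the fixed field
  of \<open>\<sigma>\<close> or that \<open>m = \<epsilon> * w * \<sigma> w\<close> with \<open>w\<close> of trace zero. This is the theorem
  \<open>dependent_if_same_slope\<close>, which holds for any field with suitable automorphisms.

  So the polynomial is scattered whenever the kernels differ and \<open>m\<close> lies neither in
  \<open>P_minus q t s\<close> nor in \<open>\<epsilon>\<close> times \<open>P_plus q t s\<close>. The arithmetic hypotheses ensure this. The kernels differ by
  \<open>nondegenerate_if_norm_pm_one\<close>. If \<open>t\<close> is even or \<open>q\<close> is 1 modulo 4, then \<open>P_plus q t s\<close> equals its
  negative, so the sign \<open>\<epsilon>\<close> is harmless. If \<open>t\<close> is odd and \<open>q\<close> is 3 modulo 4, the nonzero elements of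
  \<open>P_plus q t s\<close> are squares in \<open>K\<close>, while those of \<open>P_minus q t s\<close> and of the negative of
  \<open>P_plus q t s\<close> are not; hence for \<open>\<epsilon> = -1\<close> every nonzero \<open>m\<close> in \<open>P_plus q t s\<close> is allowed.
\<close>

section \<open>Semilinear maps over the fixed field of an involution\<close>

locale field_endomorphism =
  fixes f :: "'a :: field \<Rightarrow> 'a"
  assumes add [simp]: "f (x + y) = f x + f y"
    and mult [simp]: "f (x * y) = f x * f y"
    and one [simp]: "f 1 = 1"
begin

lemma zero [simp]: "f 0 = 0"
  by (metis add add_cancel_right_left)

lemma minus [simp]: "f (- x) = - f x"
  using add[of x "- x"] by (simp add: eq_neg_iff_add_eq_0 add.commute)

lemma diff [simp]: "f (x - y) = f x - f y"
  using add[of x "- y"] by simp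

lemma eq_0_iff [simp]: "f x = 0 \<longleftrightarrow> x = 0"
  using mult[of x "inverse x"] by (cases "x = 0") auto

lemma divide [simp]: "f (x / y) = f x / f y"
  using mult[of "x / y" y] by (cases "y = 0") (auto simp: field_simps)

end

locale involution_automorphism =
  \<sigma>: field_endomorphism \<sigma> + \<tau>: field_endomorphism \<tau> + conj: field_endomorphism conj
  for \<sigma> \<tau> conj :: "'a :: field \<Rightarrow> 'a" +
  assumes \<sigma>_\<tau> [simp]: "\<sigma> (\<tau> x) = x"
    and \<tau>_\<sigma> [simp]: "\<tau> (\<sigma> x) = x"
    and conj_conj [simp]: "conj (conj x) = x"
    and conj_\<sigma> [simp]: "conj (\<sigma> x) = \<sigma> (conj x)"
begin

lemma conj_\<tau> [simp]: "conj (\<tau> x) = \<tau> (conj x)"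
  by (metis \<sigma>_\<tau> \<tau>_\<sigma> conj_\<sigma>)

text \<open>The classical resolvent \<open>x + c * conj x\<close> is an eigenvector; \<open>x = 1\<close> serves unless
  \<open>c = -1\<close>, and then any \<open>r\<close> moved by \<open>conj\<close> does.\<close>

lemma hilbert_90_involution:
  assumes "c * conj c = 1" and "conj r \<noteq> r"
  obtains u where "u \<noteq> 0" and "u = c * conj u"
proof (cases "c = -1")
  case True
  show ?thesis
    by (rule that[of "r - conj r"]) (use True assms in auto)
next
  case False
  show ?thesis
    by (rule that[of "1 + c"])
      (use False assms in \<open>auto simp: algebra_simps eq_neg_iff_add_eq_0\<close>)
qed

end

text \<open>Here \<open>u\<close> spans the kernel of \<open>\<alpha>\<close> and \<open>v\<close> the kernel of \<open>\<beta>\<close> below, both over the fixed field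
  \<open>K\<close> of \<open>conj\<close>: such a line is recorded by the ratio of its elements to their conjugates.
  The two ratios differ exactly when \<open>nondegenerate\<close> holds, so \<open>u\<close> and \<open>v\<close> form a
  \<open>K\<close>-basis adapted to the pair \<open>\<alpha>, \<beta>\<close>.\<close>

locale adapted_basis = involution_automorphism \<sigma> \<tau> conj
  for \<sigma> \<tau> conj :: "'a :: field \<Rightarrow> 'a" +
  fixes h \<epsilon> u v :: 'a
  assumes \<epsilon>: "\<epsilon> = 1 \<or> \<epsilon> = -1"
    and h_nonzero [simp]: "h \<noteq> 0"
    and conj_h [simp]: "conj h = \<epsilon> / h"
    and nondegenerate: "1 + \<epsilon> * h * \<sigma> (\<sigma> h) \<noteq> 0"
    and u_nonzero [simp]: "u \<noteq> 0"
    and conj_u [simp]: "conj u = \<epsilon> * u / (h * \<tau> h)"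
    and v_nonzero [simp]: "v \<noteq> 0"
    and conj_v [simp]: "conj v = - (\<sigma> h * v / h)"
begin

definition \<alpha> :: "'a \<Rightarrow> 'a" where
  "\<alpha> x = \<sigma> x - \<epsilon> * h * \<sigma> h * \<sigma> (conj x)"

definition \<beta> :: "'a \<Rightarrow> 'a" where
  "\<beta> x = \<tau> (conj x) + h / \<tau> h * \<tau> x"

definition P :: 'a where
  "P = 1 + \<epsilon> * h * \<sigma> (\<sigma> h)"

lemma \<epsilon>_square [simp]: "\<epsilon> * \<epsilon> = 1" "\<epsilon> * (\<epsilon> * x) = x"
  and \<epsilon>_nonzero [simp]: "\<epsilon> \<noteq> 0"
  and \<sigma>_\<epsilon> [simp]: "\<sigma> \<epsilon> = \<epsilon>" and \<tau>_\<epsilon> [simp]: "\<tau> \<epsilon> = \<epsilon>" and conj_\<epsilon> [simp]: "conj \<epsilon> = \<epsilon>"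
  using \<epsilon> by auto

lemma P_nonzero [simp]: "P \<noteq> 0"
  using nondegenerate by (simp add: P_def)

lemma conj_P: "conj P = \<epsilon> * P / (h * \<sigma> (\<sigma> h))"
  using \<epsilon> by (auto simp: P_def field_simps)

lemma \<alpha>_semilinear: "conj a = a \<Longrightarrow> \<alpha> (a * x) = \<sigma> a * \<alpha> x"
  and \<beta>_semilinear: "conj a = a \<Longrightarrow> \<beta> (a * x) = \<tau> a * \<beta> x"
  by (simp_all add: \<alpha>_def \<beta>_def algebra_simps add_divide_distrib)

lemma \<alpha>_add: "\<alpha> (x + y) = \<alpha> x + \<alpha> y"
  and \<beta>_add: "\<beta> (x + y) = \<beta> x + \<beta> y"
  by (simp_all add: \<alpha>_def \<beta>_def algebra_simps add_divide_distrib)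

lemma \<alpha>_u [simp]: "\<alpha> u = 0" and \<beta>_v [simp]: "\<beta> v = 0"
  using \<epsilon> by (auto simp: \<alpha>_def \<beta>_def field_simps)

lemma \<alpha>_v: "\<alpha> v = \<sigma> v * P"
  by (simp add: \<alpha>_def P_def field_simps)

lemma \<beta>_u: "\<beta> u = \<epsilon> * \<tau> u * \<tau> (\<tau> P) / (\<tau> h * \<tau> (\<tau> h))"
  using \<epsilon> by (auto simp: \<beta>_def P_def field_simps)

lemma conj_\<alpha>_v: "conj (\<alpha> v) = - \<epsilon> * \<alpha> v / (h * \<sigma> h)"
  using \<epsilon> by (auto simp: \<alpha>_v conj_P field_simps)

lemma conj_\<beta>_u: "conj (\<beta> u) = \<tau> h / h * \<beta> u"
  using \<epsilon> by (auto simp: \<beta>_u conj_P field_simps)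

lemma \<tau>_P: "\<tau> P = 1 + \<epsilon> * \<sigma> h * \<tau> h"
  by (simp add: P_def)

text \<open>Cramer's rule for \<open>x = a * u + b * v\<close> together with its conjugate. The determinant is a
  multiple of \<open>\<tau> P\<close>, hence nonzero by nondegeneracy.\<close>

lemma coordinates:
  obtains a b where "conj a = a" "conj b = b" "x = a * u + b * v"
proof -
  define d where "d = conj u * v - u * conj v"
  have d: "d = \<epsilon> * u * v / (h * \<tau> h) * \<tau> P"
    using \<epsilon> by (auto simp: d_def \<tau>_P field_simps)
  then have d0: "d \<noteq> 0"
    by simp
  have cd: "conj d = - d"
    unfolding d_def by (simp del: conj_u conj_v)
  show ?thesis
  proof (rule that)
    show "conj ((conj x * v - x * conj v) / d) = (conj x * v - x * conj v) / d"
      using d0 by (simp add: cd del: conj_u conj_v) (simp add: field_simps)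
    show "conj ((conj u * x - u * conj x) / d) = (conj u * x - u * conj x) / d"
      using d0 by (simp add: cd del: conj_u conj_v) (simp add: field_simps)
    have "(conj x * v - x * conj v) * u + (conj u * x - u * conj x) * v = x * d"
      unfolding d_def by (simp add: algebra_simps del: conj_u conj_v)
    then show "x = (conj x * v - x * conj v) / d * u + (conj u * x - u * conj x) / d * v"
      using d0 by (simp add: field_simps del: conj_u conj_v)
  qed
qed

text \<open>The factor multiplying \<open>Y / \<sigma> Y\<close> in the resulting formula for \<open>m\<close> is itself of the form
  \<open>\<sigma> x / x\<close>. This comes from writing every factor \<open>\<tau> (\<tau> P) / P\<close>, \<open>\<sigma> h / \<tau> (\<tau> h)\<close>,
  \<open>\<tau> u / u\<close>, \<open>v / \<sigma> v\<close> as a quotient of this kind; collecting the \<open>x\<close> gives \<open>w\<close>.\<close>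

lemma trace_zero_for_quotient:
  assumes "m * \<alpha> v * u * \<sigma> Y = \<epsilon> * \<sigma> h * \<tau> h * \<beta> u * v * Y" and "conj Y = Y" and "Y \<noteq> 0"
  obtains w where "w \<noteq> 0" and "conj w = - w" and "\<sigma> w = m * w"
proof (rule that)
  define w where "w = h * \<tau> h * \<tau> (\<tau> h) / (Y * \<tau> u * v * \<tau> (\<tau> P) * \<tau> P)"
  show "w \<noteq> 0"
    using assms by (simp add: w_def)
  show "conj w = - w"
    using \<epsilon> assms by (auto simp: w_def conj_P field_simps)
  have "m = \<epsilon> * \<sigma> h * \<tau> h * \<beta> u * v * Y / (\<alpha> v * u * \<sigma> Y)"
    using assms by (simp add: \<alpha>_v field_simps)
  then show "\<sigma> w = m * w"
    using assms by (simp add: w_def \<alpha>_v \<beta>_u field_simps)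
qed

text \<open>Up to \<open>\<epsilon>\<close>, all factors of \<open>m\<close> have the form \<open>x * \<sigma> x\<close>; for \<open>\<tau> (\<tau> P) / P\<close> take
  \<open>x = \<tau> (\<tau> P) / \<tau> P\<close>.\<close>

lemma trace_zero_for_product:
  assumes "m * \<alpha> v * v = \<beta> u * u * \<kappa> * \<tau> \<kappa>" and "conj \<kappa> = \<kappa>"
  obtains w where "conj w = - w" and "m = \<epsilon> * w * \<sigma> w"
proof (rule that)
  define w where "w = \<tau> \<kappa> * \<tau> u * \<tau> (\<tau> P) / (\<tau> (\<tau> h) * v * \<tau> P)"
  show "conj w = - w"
    using \<epsilon> assms by (auto simp: w_def conj_P field_simps)
  have "m = \<beta> u * u * \<kappa> * \<tau> \<kappa> / (\<alpha> v * v)"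
    using assms by (simp add: \<alpha>_v field_simps)
  then show "m = \<epsilon> * w * \<sigma> w"
    by (simp add: w_def \<alpha>_v \<beta>_u field_simps)
qed

text \<open>In the coordinates of \<open>y\<close> and \<open>z\<close>, the hypothesis \<open>eq\<close> has two kinds of coefficients: those
  of the terms \<open>R\<close> are in \<open>K\<close> after division by \<open>h\<close>, those of \<open>S\<close> are not. Comparison with
  the conjugate equation isolates \<open>Y\<close>, and the two possibilities \<open>Y \<noteq> 0\<close> and \<open>Y = 0\<close> lead to
  the two excluded shapes of \<open>m\<close>, or else to dependence of \<open>y\<close> and \<open>z\<close>.\<close>

theorem dependent_if_same_slope:
  assumes conj_m: "conj m = m"
    and not_quotient: "\<And>w. \<lbrakk>w \<noteq> 0; conj w = - w\<rbrakk> \<Longrightarrow> \<sigma> w \<noteq> m * w"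
    and not_product: "\<And>w. conj w = - w \<Longrightarrow> m \<noteq> \<epsilon> * w * \<sigma> w"
    and y: "y \<noteq> 0"
    and eq: "(m * \<alpha> y + \<beta> y) * z = (m * \<alpha> z + \<beta> z) * y"
  obtains c where "\<sigma> c = c" and "z = c * y"
proof -
  obtain a b where ab [simp]: "conj a = a" "conj b = b" and y_eq: "y = a * u + b * v"
    by (rule coordinates)
  obtain a' b' where ab' [simp]: "conj a' = a'" "conj b' = b'" and z_eq: "z = a' * u + b' * v"
    by (rule coordinates)
  define Y where "Y = \<tau> a * b' - \<tau> a' * b"
  define Z where "Z = \<sigma> b * b' - \<sigma> b' * b"
  define W where "W = \<tau> a * a' - \<tau> a' * a"
  define R where "R = m * \<alpha> v * v * Z + \<beta> u * u * W"
  define S where "S = m * \<alpha> v * u * \<sigma> Y - \<beta> u * v * Y"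
  have \<psi>y: "m * \<alpha> y + \<beta> y = m * \<sigma> b * \<alpha> v + \<tau> a * \<beta> u"
    and \<psi>z: "m * \<alpha> z + \<beta> z = m * \<sigma> b' * \<alpha> v + \<tau> a' * \<beta> u"
    by (simp_all add: y_eq z_eq \<alpha>_add \<beta>_add \<alpha>_semilinear \<beta>_semilinear)
  have RS: "R = S"
    using eq unfolding \<psi>y \<psi>z unfolding y_eq z_eq R_def S_def Y_def Z_def W_def by (simp add: algebra_simps)
  have real: "conj Y = Y" "conj Z = Z" "conj W = W"
    by (simp_all add: Y_def Z_def W_def)
  \<comment> \<open>Since \<open>h / conj h = \<epsilon> * h * h\<close> is also the ratio of \<open>\<alpha> v * v\<close> and of \<open>\<beta> u * u\<close> to
    their conjugates, dividing by \<open>h\<close> puts \<open>R\<close> into \<open>K\<close>.\<close>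
  have "conj (R / h) = R / h"
    using \<epsilon> by (auto simp: R_def real conj_m conj_\<alpha>_v conj_\<beta>_u field_simps)
  then have "conj (S / h) = S / h"
    using RS by simp
  \<comment> \<open>Both coefficients of \<open>S / h\<close> minus its conjugate contain \<open>1 + \<epsilon> * \<sigma> h * \<tau> h = \<tau> P\<close>.\<close>
  then have "h * h * ((m * \<alpha> v * u * \<sigma> Y - \<epsilon> * \<sigma> h * \<tau> h * \<beta> u * v * Y) * \<tau> P) = 0"
    using \<epsilon> by (auto simp: S_def real conj_m conj_\<alpha>_v conj_\<beta>_u field_simps \<tau>_P)
  then have Y_eq: "m * \<alpha> v * u * \<sigma> Y = \<epsilon> * \<sigma> h * \<tau> h * \<beta> u * v * Y"
    by simp
  have Y0: "Y = 0"
    using trace_zero_for_quotient[OF Y_eq real(1)] not_quotient by blast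
  then have R0: "R = 0"
    using RS by (simp add: S_def)
  have "\<sigma> Y = 0"
    using Y0 by simp
  then have cross: "a * \<sigma> b' = a' * \<sigma> b"
    by (simp add: Y_def)
  show ?thesis
  proof (cases "b = 0")
    case b: True
    then have a: "a \<noteq> 0"
      using y y_eq by auto
    with cross b have b': "b' = 0"
      by simp
    have "\<beta> u * u \<noteq> 0"
      by (simp add: \<beta>_u)
    then have "W = 0"
      using R0 b b' by (simp add: R_def Z_def)
    then have "\<sigma> W = 0"
      by simp
    then have "\<sigma> (a' / a) = a' / a"
      using a by (simp add: W_def field_simps)
    moreover have "z = a' / a * y"
      using a by (simp add: y_eq z_eq b b')
    ultimately show ?thesis
      using that by blast
  next
    case b: False
    \<comment> \<open>\<open>Y = 0\<close> makes \<open>(a, a')\<close> proportional to \<open>(\<sigma> b, \<sigma> b')\<close>, which turns \<open>W\<close> into a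
      multiple of \<open>Z\<close>.\<close>
    define \<kappa> where "\<kappa> = a / \<sigma> b"
    have a: "a = \<kappa> * \<sigma> b" and a': "a' = \<kappa> * \<sigma> b'"
      using b cross by (simp_all add: \<kappa>_def field_simps)
    have "W = - (\<kappa> * \<tau> \<kappa> * Z)"
      by (simp add: W_def Z_def a a' algebra_simps)
    then have "(m * \<alpha> v * v - \<beta> u * u * \<kappa> * \<tau> \<kappa>) * Z = 0"
      using R0 by (simp add: R_def algebra_simps)
    moreover have "conj \<kappa> = \<kappa>"
      by (simp add: \<kappa>_def)
    then have "m * \<alpha> v * v \<noteq> \<beta> u * u * \<kappa> * \<tau> \<kappa>"
      using trace_zero_for_product not_product by metis
    ultimately have "Z = 0"
      by simp
    then have c: "\<sigma> (b' / b) = b' / b"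
      using b by (simp add: Z_def field_simps)
    have "\<sigma> b' = b' / b * \<sigma> b"
      using c b by (simp add: field_simps)
    then have "z = b' / b * y"
      using b unfolding z_eq y_eq a a' by (simp add: field_simps)
    with c show ?thesis
      using that by blast
  qed
qed

end

section \<open>Powers in finite fields\<close>

text \<open>Multiplication by a nonzero \<open>x\<close> permutes the nonzero elements, so it does not change their
  product.\<close>

lemma power_CARD_eq_self: "x ^ CARD('a) = x" for x :: "'a :: {field, finite}"
proof (cases "x = 0")
  case False
  have "x * (\<Prod>y\<in>UNIV-{0}. x * y) = x ^ Suc (CARD('a) - 1) * \<Prod>(UNIV-{0})"
    unfolding power_Suc by (simp add: prod.distrib mult_ac card_Diff_singleton)
  also have "(\<Prod>y\<in>UNIV-{0}. x * y) = (\<Prod>y\<in>UNIV-{0}. y)"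
    by (rule prod.reindex_bij_witness[of _ "\<lambda>y. y / x" "\<lambda>y. x * y"]) (use False in auto)
  finally show ?thesis
    using zero_less_card_finite[where 'a = 'a] by simp
qed (simp add: zero_less_card_finite)

lemma frobenius_power_cong:
  fixes x :: "'a :: {field, finite}"
  assumes card: "CARD('a) = q ^ n" and "[i = j] (mod n)"
  shows "x ^ (q ^ i) = x ^ (q ^ j)"
proof -
  have period: "x ^ (q ^ (n * k)) = x" for x :: 'a and k
    by (induction k) (simp_all add: power_add power_mult power_CARD_eq_self flip: card)
  have reduce: "x ^ (q ^ i) = x ^ (q ^ (i mod n))" for i
  proof -
    have "x ^ (q ^ (n * (i div n) + i mod n)) = (x ^ (q ^ (n * (i div n)))) ^ (q ^ (i mod n))"
      by (simp only: power_add power_mult)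
    then show ?thesis
      by (simp add: period)
  qed
  show ?thesis
    using assms(2) by (metis reduce cong_def)
qed

lemma frobenius_power_comp:
  "(x ^ (q ^ i)) ^ (q ^ j) = x ^ (q ^ (i + j))" for x :: "'a :: monoid_mult" and q :: nat
  by (simp add: power_add flip: power_mult)

lemma odd_mult_cong: "odd s \<Longrightarrow> [s * t = t] (mod 2 * t)" for s t :: nat
proof (elim oddE)
  fix k
  assume "s = 2 * k + 1"
  then have "s * t = t + 2 * t * k"
    by (simp add: algebra_simps)
  then show ?thesis
    by (simp add: cong_def)
qed

lemma power_primepow_add:
  fixes x y :: "'a :: {field, finite}"
  assumes "primepow q" and "CARD('a) = q ^ n"
  shows "(x + y) ^ (q ^ i) = x ^ (q ^ i) + y ^ (q ^ i)"
proof -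
  obtain p k where p: "prime p" and q: "q = p ^ k"
    using assms(1) by (auto simp: primepow_def)
  have "CHAR('a) > 0"
    by (rule finite_imp_CHAR_pos) simp
  then have prime: "prime CHAR('a)"
    by (rule prime_CHAR_semidom)
  have "CHAR('a) dvd p ^ (k * n)"
    using CHAR_dvd_CARD[where 'a = 'a] assms(2) by (simp add: q power_mult)
  then have "CHAR('a) = p"
    using prime p by (metis prime_dvd_power primes_dvd_imp_eq)
  then show ?thesis
    using freshmans_dream'[OF prime, of "q ^ i" "k * i" x y] by (simp add: q power_mult)
qed

text \<open>The polynomial \<open>X^(d * e) - 1\<close> cannot vanish on all \<open>2 * d * e\<close> nonzero elements, so some
  element \<open>z\<close> has \<open>z^(d * e) = -1\<close>. This one fact supplies all the elements needed later:
  \<open>d = q^t - 1\<close> gives a nonzero element of trace zero, \<open>d = 2\<close> a square root of \<open>-1\<close>, and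
  \<open>d = q + 1\<close> an element of norm \<open>-1\<close> over the field of order \<open>q\<close>.\<close>

lemma exists_power_eq_minus_one:
  assumes "2 * d dvd CARD('a :: {field, finite}) - 1"
  obtains w :: "'a :: {field, finite}" where "w ^ d = - 1"
proof -
  obtain e where e: "CARD('a) - 1 = 2 * d * e"
    using assms by (elim dvdE)
  have "card {0, 1 :: 'a} \<le> CARD('a)"
    by (rule card_mono) simp_all
  then have pos: "d * e > 0"
    using e by (cases "d * e = 0") (auto simp: mult.assoc)
  let ?p = "monom 1 (d * e) - 1 :: 'a poly"
  have deg: "degree ?p \<le> d * e"
    by (rule degree_diff_le) (simp_all add: degree_monom_le)
  have "poly ?p 0 \<noteq> 0"
    using pos by (simp add: poly_monom power_0_left)
  then have "?p \<noteq> 0"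
    by force
  have "\<exists>z :: 'a. z \<noteq> 0 \<and> z ^ (d * e) \<noteq> 1"
  proof (rule ccontr)
    assume "\<not> ?thesis"
    then have "z ^ (d * e) = 1" if "z \<noteq> 0" for z :: 'a
      using that by blast
    then have "UNIV - {0} \<subseteq> {z. poly ?p z = 0}"
      by (auto simp: poly_monom)
    then have "card (UNIV - {0 :: 'a}) \<le> card {z. poly ?p z = 0}"
      by (rule card_mono[rotated]) simp
    also have "\<dots> \<le> d * e"
      using card_poly_roots_bound[OF \<open>?p \<noteq> 0\<close>] deg by linarith
    finally show False
      using pos e by (simp add: card_Diff_singleton)
  qed
  then obtain z :: 'a where z: "z \<noteq> 0" "z ^ (d * e) \<noteq> 1"
    by blast
  have "z * z ^ (CARD('a) - 1) = z"
    using power_CARD_eq_self[of z] zero_less_card_finite[where 'a = 'a]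
    by (metis Suc_pred' power_Suc)
  then have "z ^ (d * e * 2) = 1"
    using z(1) e by (simp add: mult_ac)
  then have "(z ^ (d * e))\<^sup>2 = 1"
    by (simp only: power_mult)
  then have "z ^ (d * e) = - 1"
    using z(2) unfolding power2_eq_1_iff by simp
  then have "(z ^ e) ^ d = - 1"
    by (simp add: mult.commute flip: power_mult)
  then show ?thesis
    by (rule that)
qed

lemma involution_automorphism_frobenius:
  assumes "primepow q" and card: "CARD('a :: {field, finite}) = q ^ (2 * t)" and "t > 0"
  shows "involution_automorphism (\<lambda>x :: 'a :: {field, finite}. x ^ (q ^ s))
           (\<lambda>x. x ^ (q ^ (s * (2 * t - 1)))) (\<lambda>x. x ^ (q ^ t))"
proof -
  have endo: "field_endomorphism (\<lambda>x :: 'a. x ^ (q ^ i))" for i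
    by unfold_locales (simp_all add: power_primepow_add[OF assms(1) card] power_mult_distrib)
  have id: "x ^ (q ^ i) = x" if "[i = 0] (mod 2 * t)" for x :: 'a and i
    using frobenius_power_cong[OF card that, of x] by simp
  have eq: "s + s * (2 * t - Suc 0) = 2 * t * s"
    using \<open>t > 0\<close> by (cases t) (simp_all add: algebra_simps)
  show ?thesis
    by (intro involution_automorphism.intro involution_automorphism_axioms.intro endo;
        (simp only: frobenius_power_comp)?)
      (auto intro!: id simp: eq cong_def add.commute mult_2[symmetric])
qed

section \<open>Residues modulo 4, nondegeneracy and the trace-zero sets\<close>

lemma power_eq_self_mod_4:
  fixes x :: "'a :: monoid_mult"
  assumes "x ^ 4 = 1" and "n mod 4 = 1"
  shows "x ^ n = x"
proof -
  have "x ^ (4 * (n div 4) + n mod 4) = x"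
    unfolding power_add power_mult assms by simp
  then show ?thesis
    by simp
qed

lemma two_neq_zero_if_odd_card:
  assumes "odd (CARD('a :: {field, finite}))"
  shows "(2 :: 'a :: {field, finite}) \<noteq> 0"
proof
  assume "(2 :: 'a) = 0"
  then have "CHAR('a) dvd 2"
    using of_nat_eq_0_iff_char_dvd[of 2, where 'a = 'a] by simp
  moreover have "CHAR('a) dvd CARD('a)"
    by (rule CHAR_dvd_CARD)
  moreover have "coprime 2 CARD('a)"
    using assms by simp
  ultimately have "is_unit CHAR('a)"
    by (meson coprime_common_divisor)
  then show False
    by simp
qed

lemma odd_power_mod_4: "q mod 4 = (3 :: nat) \<Longrightarrow> odd n \<Longrightarrow> q ^ n mod 4 = 3"
proof -
  assume q: "q mod 4 = 3" and "odd n"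
  then obtain k where n: "n = 2 * k + 1"
    by (elim oddE)
  have "q\<^sup>2 mod 4 = 1"
    using power_mod[of q 4 2] q by simp
  then have "(q\<^sup>2) ^ k mod 4 = 1"
    using power_mod[of "q\<^sup>2" 4 k] by simp
  then have "(q\<^sup>2) ^ k * q mod 4 = 3"
    using mod_mult_eq[of "(q\<^sup>2) ^ k" 4 q] q by simp
  then show ?thesis
    by (simp only: n power_mult power_add power_one_right)
qed

lemma even_power_mod_4: "odd (q :: nat) \<Longrightarrow> even n \<Longrightarrow> q ^ n mod 4 = 1"
proof -
  assume "odd q" and "even n"
  then obtain j k where q: "q = 2 * j + 1" and n: "n = 2 * k"
    by (elim oddE evenE)
  have "q\<^sup>2 = 1 + 4 * (j\<^sup>2 + j)"
    by (simp add: q power2_eq_square algebra_simps)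
  then have "q\<^sup>2 mod 4 = 1"
    by (metis mod_mult_self2 mod_less one_less_numeral_iff semiring_norm(76))
  then show ?thesis
    using power_mod[of "q\<^sup>2" 4 k] by (simp add: n power_mult)
qed

text \<open>If the expression vanished, the square of the automorphism \<open>x \<mapsto> x^(q^s)\<close> would map \<open>h\<close> to
  \<open>-\<epsilon> / h\<close>, and its powers would alternate between \<open>h\<close> and \<open>-\<epsilon> / h\<close>. For even \<open>t\<close> some power of
  this square is \<open>x \<mapsto> x^(q^t)\<close>, which maps \<open>h\<close> to \<open>\<epsilon> / h\<close>; for odd \<open>t\<close> its \<open>t\<close>-th power is
  the identity. Either this is absurd at once, or \<open>h * h = \<epsilon>\<close> or \<open>h * h = -\<epsilon>\<close>, hence \<open>h^4 = 1\<close>, and residues modulo 4 decide.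
  The one surviving possibility is \<open>h^2 = -1\<close> with \<open>\<epsilon> = 1\<close>, \<open>t\<close> odd and \<open>q\<close> congruent to 3
  modulo 4.\<close>

lemma nondegenerate_if_norm_pm_one:
  fixes h :: "'a :: {field, finite}"
  assumes card: "CARD('a) = q ^ (2 * t)" and "odd q" and "odd s"
    and \<epsilon>: "\<epsilon> = 1 \<or> \<epsilon> = - 1" and norm: "h * h ^ (q ^ t) = \<epsilon>"
    and cases: "even t \<or> q mod 4 = 1 \<or> \<epsilon> = - 1 \<or> h\<^sup>2 \<noteq> - 1"
  shows "1 + \<epsilon> * h * (h ^ (q ^ s)) ^ (q ^ s) \<noteq> 0"
proof
  assume degenerate: "1 + \<epsilon> * h * (h ^ (q ^ s)) ^ (q ^ s) = 0"
  have two: "(2 :: 'a) \<noteq> 0"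
    by (rule two_neq_zero_if_odd_card) (simp add: card \<open>odd q\<close>)
  have \<epsilon>2: "\<epsilon> * \<epsilon> = 1" "\<epsilon> \<noteq> 0" "- \<epsilon> \<noteq> \<epsilon>"
    using \<epsilon> two by (auto simp: eq_commute[of "- 1"] eq_neg_iff_add_eq_0[of 1])
  have h: "h \<noteq> 0"
    using norm \<epsilon>2 by auto
  have odd_pow: "odd (q ^ i)" for i
    using \<open>odd q\<close> by simp
  have neg: "(- \<epsilon>) ^ (q ^ i) = - \<epsilon>" for i
    using \<epsilon> odd_pow[of i] by auto
  have step: "h ^ (q ^ (2 * s)) = - \<epsilon> / h"
  proof -
    have "h ^ (q ^ (2 * s)) = (h ^ (q ^ s)) ^ (q ^ s)"
      by (simp only: power_add power_mult mult_2)
    then have "1 + \<epsilon> * (h * h ^ (q ^ (2 * s))) = 0"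
      using degenerate by (simp add: mult.assoc)
    then have "\<epsilon> * (1 + \<epsilon> * (h * h ^ (q ^ (2 * s)))) = 0"
      by simp
    then have "\<epsilon> + h * h ^ (q ^ (2 * s)) = 0"
      using \<epsilon>2 by (simp add: distrib_left flip: mult.assoc)
    then show ?thesis
      using h by (simp add: field_simps eq_neg_iff_add_eq_0)
  qed
  have iter: "h ^ (q ^ (2 * s * i)) = (if even i then h else - \<epsilon> / h)" for i
  proof (induction i)
    case (Suc i)
    have "h ^ (q ^ (2 * s * Suc i)) = (h ^ (q ^ (2 * s * i))) ^ (q ^ (2 * s))"
      by (simp add: power_add mult.commute flip: power_mult)
    moreover have "(- \<epsilon> / h) ^ (q ^ (2 * s)) = h"
      unfolding power_divide neg step using h \<epsilon>2 by simp
    ultimately show ?case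
      using Suc.IH step by simp
  qed simp
  have conj: "h ^ (q ^ t) = \<epsilon> / h"
    using norm h by (simp add: field_simps)
  have clash: False if "h * h = \<epsilon>" and "h * h = - \<epsilon>"
    using that \<epsilon>2 by simp
  have fourth: "h ^ 4 = 1" if "h * h = \<epsilon> \<or> h * h = - \<epsilon>"
  proof -
    have "h ^ 4 = (h * h) * (h * h)"
      by (simp add: numeral_eq_Suc)
    then show ?thesis
      using that \<epsilon>2 by auto
  qed
  show False
  proof (cases "even t")
    case True
    then obtain j where j: "t = 2 * j"
      by (elim evenE)
    have "h ^ (q ^ (2 * s * j)) = h ^ (q ^ t)"
      using frobenius_power_cong[OF card odd_mult_cong[OF \<open>odd s\<close>], of h] by (simp add: j mult_ac)
    then have "(if even j then h else - \<epsilon> / h) = \<epsilon> / h"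
      by (simp add: iter conj)
    then have sq: "h * h = \<epsilon>"
      using h \<epsilon>2 by (auto simp: field_simps split: if_splits)
    have "h ^ (q ^ (2 * s)) = h"
      by (rule power_eq_self_mod_4) (use fourth sq even_power_mod_4[OF \<open>odd q\<close>] in auto)
    then have "h * h = - \<epsilon>"
      using step h by (simp add: field_simps)
    with sq show False
      by (rule clash)
  next
    case odd: False
    have "[2 * s * t = 0] (mod 2 * t)"
      by (simp add: cong_def)
    then have "h ^ (q ^ (2 * s * t)) = h"
      using frobenius_power_cong[OF card, of "2 * s * t" 0] by simp
    then have "h = - \<epsilon> / h"
      using odd unfolding iter by simp
    then have sq: "h * h = - \<epsilon>"
      using h unfolding eq_divide_eq by simp
    have "h ^ (q ^ t) = h"
    proof (cases "q mod 4 = 1")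
      case True
      then have "q ^ t mod 4 = 1"
        using power_mod[of q 4 t] by simp
      then show ?thesis
        using fourth sq power_eq_self_mod_4 by blast
    next
      case False
      then have "h\<^sup>2 = 1"
        using cases odd sq \<epsilon> by (auto simp: power2_eq_square)
      moreover obtain k where "q ^ t = 2 * k + 1"
        using odd_pow[of t] by (elim oddE)
      ultimately show ?thesis
        by (simp add: power_mult)
    qed
    then have "h * h = \<epsilon>"
      using norm by simp
    then show False
      using sq by (rule clash)
  qed
qed

text \<open>Multiplying trace-zero elements by such a \<open>z\<close> shows that the set \<open>P_plus q t s\<close> is closed under
  negation. The witness is a square root of \<open>-1\<close> in the field of order \<open>q\<close>, or an element of the
  field of order \<open>q^2\<close> with norm \<open>-1\<close>; that field lies in the field of order \<open>q^t\<close> for even \<open>t\<close>.\<close>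

lemma minus_one_is_twisted_norm:
  assumes card: "CARD('a :: {field, finite}) = q ^ (2 * t)" and "t > 0" and "odd q" and "odd s"
    and cases: "even t \<or> q mod 4 = 1"
  obtains z :: "'a :: {field, finite}" where "z ^ (q ^ t) = z" and "z ^ (q ^ s + 1) = - 1"
proof (cases "q mod 4 = 1")
  case True
  have "(q ^ (2 * t)) mod 4 = 1"
    using \<open>odd q\<close> by (simp add: even_power_mod_4)
  then have "2 * 2 dvd CARD('a) - 1"
    unfolding card by presburger
  then obtain z :: 'a where z: "z\<^sup>2 = - 1"
    by (rule exists_power_eq_minus_one)
  then have "z ^ 4 = 1"
    using power_mult[of z 2 2] by simp
  moreover have "q ^ i mod 4 = 1" for i
    using True power_mod[of q 4 i] by simp
  ultimately have "z ^ (q ^ i) = z" for i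
    by (rule power_eq_self_mod_4)
  then show ?thesis
    using z by (intro that[of z]) (simp_all add: power2_eq_square)
next
  case False
  then have "even t"
    using cases by simp
  have "2 dvd q - 1"
    using \<open>odd q\<close> by simp
  then have "2 * (q + 1) dvd (q - 1) * (q + 1)"
    by (rule mult_dvd_mono) simp
  also have "(q - 1) * (q + 1) = q\<^sup>2 - 1"
    by (simp add: power2_eq_square algebra_simps)
  also have "q\<^sup>2 - 1 dvd (q\<^sup>2) ^ t - 1"
  proof -
    have "q\<^sup>2 = q\<^sup>2 - 1 + 1"
      using \<open>odd q\<close> by (simp add: odd_pos)
    then have "[q\<^sup>2 = 1] (mod q\<^sup>2 - 1)"
      by (metis cong_def mod_add_self1)
    from cong_pow[OF this, of t] show ?thesis
      by (intro cong_to_1_nat) simp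
  qed
  finally have "2 * (q + 1) dvd CARD('a) - 1"
    by (simp add: card power_mult)
  then obtain z :: 'a where z: "z ^ (q + 1) = - 1"
    by (rule exists_power_eq_minus_one)
  then have z0: "z \<noteq> 0"
    by auto
  with z have zq: "z ^ q = - 1 / z"
    unfolding eq_divide_eq by (simp add: mult.commute)
  have "z ^ (q ^ i) = (if even i then z else - 1 / z)" for i
  proof (induction i)
    case (Suc i)
    then show ?case
      using zq z0 \<open>odd q\<close> by (simp add: power_mult power_divide mult.commute[of q])
  qed simp
  then show ?thesis
    using \<open>even t\<close> \<open>odd s\<close> z0 by (intro that[of z]) simp_all
qed

text \<open>For odd \<open>t\<close> and \<open>q\<close> congruent to 3 modulo 4, the quadratic character \<open>x \<mapsto> x^((q^t - 1) div 2)\<close>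
  of the field of order \<open>q^t\<close> is \<open>1\<close> on the nonzero elements of \<open>P_plus q t s\<close> and \<open>-1\<close> on those of
  \<open>P_minus q t s\<close>, because \<open>q^s + 1\<close> is divisible by 4 and \<open>q^s - 1\<close> is not.\<close>

context
  fixes q t s :: nat and w :: "'a :: {field, finite}"
  assumes q: "q mod 4 = 3" and t: "odd t" and s: "odd s"
    and w: "w \<noteq> 0" "w ^ (q ^ t) = - w"
begin

lemma trace_zero_power: "w ^ (q ^ t - 1) = - 1"
proof -
  have "w * w ^ (q ^ t - 1) = w ^ (q ^ t)"
    using q by (metis Suc_pred' gr0I mod_0 power_Suc power_eq_0_iff zero_neq_numeral)
  then have "w * w ^ (q ^ t - 1) = w * - 1"
    using w(2) by simp
  then show ?thesis
    using w(1) by (metis mult_left_cancel)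
qed

lemma half_exponent: "(w ^ (2 * j)) ^ ((q ^ t - 1) div 2) = (- 1) ^ j"
proof -
  obtain n where "q ^ t = 4 * n + 3"
    using odd_power_mod_4[OF q t] by (metis mult_div_mod_eq)
  then have e: "q ^ t - 1 = 2 * (2 * n + 1)"
    by simp
  have "(w ^ (2 * j)) ^ (2 * n + 1) = (w ^ (2 * (2 * n + 1))) ^ j"
    by (simp only: mult_ac flip: power_mult)
  then show ?thesis
    using trace_zero_power unfolding e by simp
qed

lemma quadratic_character_P_plus: "(w ^ (q ^ s + 1)) ^ ((q ^ t - 1) div 2) = 1"
proof -
  obtain n where "q ^ s = 4 * n + 3"
    using odd_power_mod_4[OF q s] by (metis mult_div_mod_eq)
  then have j: "q ^ s + 1 = 2 * (2 * (n + 1))"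
    by simp
  show ?thesis
    unfolding j half_exponent by simp
qed

lemma quadratic_character_P_minus: "(w ^ (q ^ s - 1)) ^ ((q ^ t - 1) div 2) = - 1"
proof -
  obtain n where "q ^ s = 4 * n + 3"
    using odd_power_mod_4[OF q s] by (metis mult_div_mod_eq)
  then have j: "q ^ s - 1 = 2 * (2 * n + 1)"
    by simp
  show ?thesis
    unfolding j half_exponent by simp
qed

end

section \<open>The polynomial as a sum of two semilinear maps\<close>

lemma linearized_poly_psi: "linearized_poly q (psi q t m h s)"
  unfolding linearized_poly_def
proof (intro allI impI)
  fix k
  assume "coeff (psi q t m h s) k \<noteq> 0"
  then have "k = q ^ s \<or> k = q ^ (s * (t + 1)) \<or> k = q ^ (s * (t - 1)) \<or> k = q ^ (s * (2 * t - 1))"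
    by (rule contrapos_np) (simp add: psi_def)
  then show "\<exists>i. k = q ^ i"
    by blast
qed

text \<open>As \<open>s\<close> is odd, \<open>s * t\<close> and \<open>t\<close> agree modulo \<open>2 * t\<close>, so the two middle terms arise from the
  two outer ones by composition with \<open>x \<mapsto> x^(q^t)\<close>. The norm condition replaces the conjugate of \<open>h\<close> by \<open>\<epsilon> / h\<close>, which
  turns \<open>h^(1 - q^(s * (t + 1)))\<close> into a product.\<close>

lemma poly_psi:
  fixes h x :: "'a :: {field, finite}"
  assumes card: "CARD('a) = q ^ (2 * t)" and "t > 0" and "odd s" and "odd q"
    and \<epsilon>: "\<epsilon> = 1 \<or> \<epsilon> = - 1" and norm: "h * h ^ (q ^ t) = \<epsilon>"
  shows "poly (psi q t m h s) x =
           m * (x ^ (q ^ s) - \<epsilon> * h * h ^ (q ^ s) * (x ^ (q ^ t)) ^ (q ^ s))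
           + ((x ^ (q ^ t)) ^ (q ^ (s * (2 * t - 1)))
              + h / h ^ (q ^ (s * (2 * t - 1))) * x ^ (q ^ (s * (2 * t - 1))))"
proof -
  have h: "h \<noteq> 0"
    using norm \<epsilon> by auto
  have powi: "h powi (1 - int n) = h / h ^ n" for n
    using h by (simp add: power_int_diff)
  have "[s * (t + 1) = t + s] (mod 2 * t)"
    using cong_add[OF odd_mult_cong[OF \<open>odd s\<close>, of t] cong_refl[of s]] by (simp add: algebra_simps)
  then have up: "y ^ (q ^ (s * (t + 1))) = (y ^ (q ^ t)) ^ (q ^ s)" for y :: 'a
    unfolding frobenius_power_comp by (rule frobenius_power_cong[OF card])
  obtain r where t: "t = Suc r"
    using \<open>t > 0\<close> gr0_implies_Suc by blast
  have "[s * t + (t + s * (t - 1)) = t + (t + s * (t - 1))] (mod 2 * t)"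
    by (intro cong_add odd_mult_cong \<open>odd s\<close> cong_refl)
  moreover have "s * t + (t + s * (t - 1)) = t + s * (2 * t - 1)"
    by (simp add: t algebra_simps)
  moreover have "[t + (t + s * (t - 1)) = s * (t - 1)] (mod 2 * t)"
    unfolding cong_def add.assoc[symmetric] mult_2[symmetric] by simp
  ultimately have "[s * (t - 1) = t + s * (2 * t - 1)] (mod 2 * t)"
    by (metis cong_sym cong_trans)
  then have down: "x ^ (q ^ (s * (t - 1))) = (x ^ (q ^ t)) ^ (q ^ (s * (2 * t - 1)))"
    unfolding frobenius_power_comp by (rule frobenius_power_cong[OF card])
  have "h ^ (q ^ t) = \<epsilon> / h"
    using norm h by (simp add: field_simps)
  moreover have "\<epsilon> ^ (q ^ s) = \<epsilon>"
    using \<epsilon> \<open>odd q\<close> by auto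
  ultimately have "h ^ (q ^ (s * (t + 1))) = \<epsilon> / h ^ (q ^ s)"
    unfolding up by (simp add: power_divide)
  then have coeff: "h / h ^ (q ^ (s * (t + 1))) = \<epsilon> * h * h ^ (q ^ s)"
    using \<epsilon> by auto
  show ?thesis
    unfolding psi_def powi coeff
    unfolding poly_add poly_diff poly_smult poly_monom up down by simp
qed

section \<open>Scatteredness\<close>

theorem theorem1p1:
  fixes q t s :: nat and m h :: "'a :: {field, finite}"
  assumes "t \<ge> 3"
    and "primepow q" and "odd q"
    and "CARD('a) = q ^ (2 * t)"
    and "1 \<le> s" and "s \<le> 2 * t - 1" and "coprime s (2 * t)"
    and "m \<in> subfield_of_order (q ^ t)" and "m \<noteq> 0"
    and "((even t \<or> (odd t \<and> [q = 1] (mod 4)))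
            \<and> m \<in> subfield_of_order (q ^ t) - (P_plus q t s \<union> P_minus q t s)
            \<and> (rel_norm (q ^ t) h = 1 \<or> rel_norm (q ^ t) h = - 1))
         \<or> (odd t \<and> [q = 3] (mod 4)
            \<and> ((m \<in> P_plus q t s \<and> rel_norm (q ^ t) h = - 1)
               \<or> (m \<in> subfield_of_order (q ^ t) - (P_plus q t s \<union> P_minus q t s)
                  \<and> rel_norm (q ^ t) h = 1 \<and> h ^ 2 \<noteq> - 1)))"
  shows "scattered q (psi q t m h s)"
proof -
  note card = assms(4)
  have t: "t > 0"
    using assms(1) by simp
  have s: "odd s"
    using assms(7) by simp
  define \<epsilon> where "\<epsilon> = h * h ^ (q ^ t)"
  define \<sigma> where "\<sigma> = (\<lambda>x :: 'a. x ^ (q ^ s))"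
  define \<tau> where "\<tau> = (\<lambda>x :: 'a. x ^ (q ^ (s * (2 * t - 1))))"
  define conj where "conj = (\<lambda>x :: 'a. x ^ (q ^ t))"
  interpret involution_automorphism \<sigma> \<tau> conj
    unfolding \<sigma>_def \<tau>_def conj_def
    by (rule involution_automorphism_frobenius[OF assms(2) card t])
  have norm: "rel_norm (q ^ t) h = \<epsilon>"
    by (simp add: rel_norm_def \<epsilon>_def)
  have \<epsilon>: "\<epsilon> = 1 \<or> \<epsilon> = - 1"
    using assms(10) unfolding norm by blast
  have pow_pos: "q ^ i > 0" for i
    using assms(3) by (simp add: odd_pos)
  have P_plusI: "w * \<sigma> w \<in> P_plus q t s" if "conj w = - w" for w
    using that by (auto simp: P_plus_def rel_trace_def conj_def \<sigma>_def intro!: exI[of _ w])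
  have P_minusI: "m' \<in> P_minus q t s" if "conj w = - w" "w \<noteq> 0" "\<sigma> w = m' * w" for w m'
  proof -
    have "w * w ^ (q ^ s - 1) = \<sigma> w"
      unfolding \<sigma>_def using pow_pos[of s] by (metis Suc_pred' power_Suc)
    then have "m' = w ^ (q ^ s - 1)"
      using that by simp
    then show ?thesis
      using that by (auto simp: P_minus_def rel_trace_def conj_def)
  qed
  have two: "(1 :: 'a) \<noteq> - 1"
    using two_neq_zero_if_odd_card[where 'a = 'a] assms(3) by (simp add: card eq_neg_iff_add_eq_0)
  \<comment> \<open>These are the two shapes of \<open>m\<close> that the semilinear argument does not allow. When \<open>m\<close> is in
    \<open>P_plus\<close>, then \<open>\<epsilon> = -1\<close> and the quadratic character rules out both.\<close>
  have avoid: "m \<notin> P_minus q t s \<and> (\<forall>w. conj w = - w \<longrightarrow> m \<noteq> \<epsilon> * w * \<sigma> w)"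
  proof (cases "m \<in> P_plus q t s")
    case False
    then have cases: "even t \<or> q mod 4 = 1 \<or> \<epsilon> = 1" and minus: "m \<notin> P_minus q t s"
      using assms(10) unfolding norm by (auto simp: cong_def)
    have "m \<noteq> \<epsilon> * w * \<sigma> w" if w: "conj w = - w" for w
    proof (cases "\<epsilon> = 1")
      case True
      then show ?thesis
        using P_plusI[OF w] False by auto
    next
      case \<epsilon>_ne_1: False
      then have "even t \<or> q mod 4 = 1"
        using cases by simp
      from minus_one_is_twisted_norm[OF card t assms(3) s this]
      obtain z :: 'a where z: "z ^ (q ^ t) = z" "z ^ (q ^ s + 1) = - 1"
        by blast
      have "z * w * \<sigma> (z * w) = (z * \<sigma> z) * (w * \<sigma> w)"
        by (simp add: mult_ac)
      also have "z * \<sigma> z = \<epsilon>"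
        using z(2) \<epsilon> \<epsilon>_ne_1 by (simp add: \<sigma>_def)
      finally have "z * w * \<sigma> (z * w) = \<epsilon> * w * \<sigma> w"
        by (simp add: mult.assoc)
      moreover have "conj (z * w) = - (z * w)"
        using w z(1) by (simp add: conj_def power_mult_distrib)
      ultimately show ?thesis
        using P_plusI[of "z * w"] False by metis
    qed
    with minus show ?thesis
      by blast
  next
    case True
    then have odd_t: "odd t" and q3: "q mod 4 = 3" and \<epsilon>_eq: "\<epsilon> = - 1"
      using assms(10) unfolding norm by (auto simp: cong_def)
    let ?e = "(q ^ t - 1) div 2"
    note character = quadratic_character_P_plus[OF q3 odd_t s] quadratic_character_P_minus[OF q3 odd_t s]
    have "odd ?e"
      using odd_power_mod_4[OF q3 odd_t] by presburger
    obtain w where w: "m = w ^ (q ^ s + 1)" "rel_trace (q ^ t) w = 0"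
      using True by (auto simp: P_plus_def)
    have trace_zero: "w ^ (q ^ t) = - w" if "rel_trace (q ^ t) w = 0" for w :: 'a
      using that by (simp add: rel_trace_def eq_neg_iff_add_eq_0 add.commute)
    have "w \<noteq> 0"
      using w assms(9) by auto
    then have m: "m ^ ?e = 1"
      using character(1)[OF _ trace_zero[OF w(2)]] w(1) by simp
    have "m \<notin> P_minus q t s"
    proof
      assume "m \<in> P_minus q t s"
      then obtain w where w: "m = w ^ (q ^ s - 1)" "rel_trace (q ^ t) w = 0"
        by (auto simp: P_minus_def)
      have "q ^ s mod 4 = 3"
        by (rule odd_power_mod_4[OF q3 s])
      then have "q ^ s - 1 \<noteq> 0"
        by presburger
      then have "w \<noteq> 0"
        using w assms(9) by (metis power_0_left)
      then have "m ^ ?e = - 1"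
        using character(2)[OF _ trace_zero[OF w(2)]] w(1) by simp
      then show False
        using m two by simp
    qed
    moreover have "m \<noteq> \<epsilon> * w * \<sigma> w" if "conj w = - w" for w
    proof
      assume eq: "m = \<epsilon> * w * \<sigma> w"
      then have "w \<noteq> 0" and "m = - (w ^ (q ^ s + 1))"
        using assms(9) by (auto simp: \<epsilon>_eq \<sigma>_def)
      then have "m ^ ?e = - 1"
        using character(1)[of w] that \<open>odd ?e\<close> by (simp add: conj_def)
      then show False
        using m two by simp
    qed
    ultimately show ?thesis
      by blast
  qed
  have nondegenerate: "1 + \<epsilon> * h * \<sigma> (\<sigma> h) \<noteq> 0"
    unfolding \<sigma>_def
  proof (rule nondegenerate_if_norm_pm_one[OF card assms(3) s \<epsilon> \<epsilon>_def[symmetric]])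
    show "even t \<or> q mod 4 = 1 \<or> \<epsilon> = - 1 \<or> h\<^sup>2 \<noteq> - 1"
      using assms(10) unfolding norm by (auto simp: cong_def)
  qed
  \<comment> \<open>A nonzero element of trace zero, which \<open>conj\<close> moves since the characteristic is odd.\<close>
  have "2 * (q ^ t - 1) dvd (q ^ t + 1) * (q ^ t - 1)"
    using assms(3) by (intro mult_dvd_mono) simp_all
  also have "(q ^ t + 1) * (q ^ t - 1) = CARD('a) - 1"
    unfolding card mult_2 power_add by (simp add: algebra_simps)
  finally obtain r :: 'a where "r ^ (q ^ t - 1) = - 1"
    by (rule exists_power_eq_minus_one)
  then have "r \<noteq> 0"
    using two by (auto simp: power_0_left split: if_splits)
  have "r * r ^ (q ^ t - 1) = conj r"
    unfolding conj_def using pow_pos[of t] by (metis Suc_pred' power_Suc)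
  then have "conj r = - r"
    using \<open>r ^ (q ^ t - 1) = - 1\<close> by simp
  have r: "conj r \<noteq> r"
  proof
    assume "conj r = r"
    then have "r * 1 = r * - 1"
      using \<open>conj r = - r\<close> by simp
    then show False
      using \<open>r \<noteq> 0\<close> two by (metis mult_left_cancel)
  qed
  have h: "h \<noteq> 0" and conj_h: "conj h = \<epsilon> / h"
    using \<epsilon> by (auto simp: \<epsilon>_def conj_def)
  have fixed: "\<sigma> \<epsilon> = \<epsilon>" "\<tau> \<epsilon> = \<epsilon>" "conj \<epsilon> = \<epsilon>" "\<epsilon> * \<epsilon> = 1"
    using \<epsilon> by auto
  have "\<epsilon> * h * \<tau> h * conj (\<epsilon> * h * \<tau> h) = 1"
    using h \<epsilon> by (auto simp: conj_h fixed)
  then obtain u where u: "u \<noteq> 0" "u = \<epsilon> * h * \<tau> h * conj u"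
    using r by (rule hilbert_90_involution)
  have "- h / \<sigma> h * conj (- h / \<sigma> h) = 1"
    using h \<epsilon> by (auto simp: conj_h fixed)
  then obtain v where v: "v \<noteq> 0" "v = - h / \<sigma> h * conj v"
    using r by (rule hilbert_90_involution)
  interpret adapted_basis \<sigma> \<tau> conj h \<epsilon> u v
  proof
    show "conj u = \<epsilon> * u / (h * \<tau> h)"
    proof -
      have "\<epsilon> * u = \<epsilon> * \<epsilon> * (h * \<tau> h * conj u)"
        using arg_cong[OF u(2), of "\<lambda>x. \<epsilon> * x"] by (simp only: mult.assoc)
      then have "\<epsilon> * u = conj u * (h * \<tau> h)"
        by (simp only: fixed(4) mult_1 mult.commute)
      moreover have "h * \<tau> h \<noteq> 0"
        using h by simp
      ultimately show ?thesis
        by (simp add: eq_divide_eq)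
    qed
    show "conj v = - (\<sigma> h * v / h)"
    proof -
      have "\<sigma> h * v = - h * conj v"
        using arg_cong[OF v(2), of "\<lambda>x. \<sigma> h * x"] h by simp
      then show ?thesis
        using h by simp
    qed
  qed (use h \<epsilon> conj_h nondegenerate u(1) v(1) in simp_all)
  have psi: "poly (psi q t m h s) x = m * \<alpha> x + \<beta> x" for x
    unfolding poly_psi[OF card t s assms(3) \<epsilon> \<epsilon>_def[symmetric]] \<alpha>_def \<beta>_def
    by (simp add: \<sigma>_def \<tau>_def conj_def)
  show ?thesis
    unfolding scattered_def
  proof (intro conjI allI impI linearized_poly_psi)
    fix y z
    assume y: "y \<noteq> 0" and "z \<noteq> 0"
      and "poly (psi q t m h s) y / y = poly (psi q t m h s) z / z"
    then have "(m * \<alpha> y + \<beta> y) * z = (m * \<alpha> z + \<beta> z) * y"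
      by (simp add: psi field_simps)
    moreover have "conj m = m"
      using assms(8) by (simp add: subfield_of_order_def conj_def)
    ultimately obtain c where c: "\<sigma> c = c" "z = c * y"
      using dependent_if_same_slope[of m y z] avoid P_minusI y by metis
    \<comment> \<open>An element fixed by \<open>\<sigma>\<close> is fixed by its powers, one of which is \<open>x \<mapsto> x^q\<close> because \<open>s\<close> is
      invertible modulo \<open>2 * t\<close>.\<close>
    have iterate: "c ^ (q ^ (s * k)) = c" for k
    proof (induction k)
      case (Suc k)
      have "c ^ (q ^ (s * Suc k)) = (c ^ (q ^ s)) ^ (q ^ (s * k))"
        by (simp only: frobenius_power_comp mult_Suc_right)
      then show ?case
        using Suc.IH c(1) by (simp add: \<sigma>_def)
    qed simp
    obtain k where "[s * k = 1] (mod 2 * t)"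
      using cong_solve_coprime_nat[OF assms(7)] by auto
    then have "c ^ q = c"
      using frobenius_power_cong[OF card, of "s * k" 1 c] iterate by simp
    then have "c \<in> subfield_of_order q" and "- 1 \<in> (subfield_of_order q :: 'a set)"
      using assms(3) by (simp_all add: subfield_of_order_def)
    then show "lin_dependent_pair q y z"
      unfolding lin_dependent_pair_def using c(2)
      by (intro bexI[of _ c] bexI[of _ "- 1"]) simp_all
  qed
qed

end
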